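(* Let $\mathcal{F}$ be a continuous-time, uncertain, piecewise linear dynamical system on $\mathbb{R}^d$ with modes $Q$, regions $(H_q)_{q\in Q}$ and matrices $(A_q)_{q\in Q}$. Let $\epsilon\ge1$, $\theta>0$, $\delta>0$ and $\bar r=\min\{\frac1\epsilon,\frac{\theta\delta}{2+\theta a_{\max}}\}$. Let $N$ be the maximal cardinality of a set $\{V_k\}_{k=1}^N$ of polyhedral functions that are solutions of the learner problem (for some finite witness sets $\{X_k\}_{k=1}^N$, $X_k\subseteq\mathbb{S}$) and that are not $\bar r$-close to each other. Then the learning algorithm described in the context terminates in at most $\min\{|Q|\,\mathrm{Pack}(\bar r;\mathbb{S}),\,N\}$ steps. Moreover, upon termination, the algorithm outputs FAIL only if System $\mathcal{F}$ does not admit an $(\epsilon,\theta,\delta)$-robust polyhedral Lyapunov function; otherwise, it outputs a polyhedral Lyapunov function for System $\mathcal{F}$.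
   Context: $\|\cdot\|$ is a vector norm on $\mathbb{R}^d$, with unit sphere $\mathbb{S}=\{x:\|x\|=1\}$, dual norm $\|c\|_*=\max\{c^\top x:x\in\mathbb{S}\}$ and induced matrix norm $\|A\|=\max\{\|Ax\|:x\in\mathbb{S}\}$. A continuous-time, uncertain, piecewise linear dynamical system is given by a finite set of modes $Q$ and, for each $q\in Q$, a closed polyhedral conic region $H_q\subseteq\mathbb{R}^d$ and a matrix $A_q\in\mathbb{R}^{d\times d}$. It is identified with the set-valued map $\mathcal{F}(x)=\{A_qx: q\in Q,\ x\in H_q\}$, and $a_{\max}=\max_{q\in Q}\|A_q\|$. A polyhedral function is $V(x)=\max_{c\in\mathcal{V}}c^\top x$ with $\mathcal{V}\subseteq\mathbb{R}^d$ finite and fixed together with $V$; $\mathcal{V}(x)=\{c\in\mathcal{V}:c^\top x=V(x)\}$ and $\mathcal{V}_{\max}=\max_{c\in\mathcal{V}}\|c\|_*$. The upper-right Dini derivative is $D^+f(x;v)=\limsup_{s\to0^+}\frac{f(x+sv)-f(x)}{s}$. A continuous $V:\mathbb{R}^d\to\mathbb{R}_{\ge0}$ is a Lyapunov function for $\mathcal{F}$ if $V(x)=0$ iff $x=0$, $V$ is radially unbounded ($\lim_{r\to\infty}\inf\{V(x):\|x\|\ge r\}=\infty$), and $D^+V(x;v)<0$ for all $x\ne0$ and $v\in\mathcal{F}(x)$. A polyhedral function $V$ is an $(\epsilon,\theta,\delta)$-robust Lyapunov function for $\mathcal{F}$ iff: (D1) for all $x\in\mathbb{R}^d$, $V(x)\ge\frac1\epsilon\mathcal{V}_{\max}\|x\|$;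 and (D2) for all $x\in\mathbb{R}^d$, $v\in\mathcal{F}(x)$, $c\in\mathcal{V}$, $c^\top v\le\frac1\theta(V(x)-c^\top x)-\delta\mathcal{V}_{\max}\|x\|$. Learner problem for a finite set $X$: find a polyhedral function $V$ with set $\mathcal{V}=\{c_x:x\in X\}\subseteq\{c:\|c\|_*\le1\}$ such that for all $x\in X$: $c_x^\top x\ge\frac1\epsilon\|x\|$, and for all $v\in\mathcal{F}(x)$ and $c\in\mathcal{V}$, $c^\top v\le\frac1\theta(c_x^\top x-c^\top x)-\delta\|x\|$. Verifier problem for $V$: find $x\in\mathbb{R}^d\setminus\{0\}$ (a counterexample) such that either $V(x)\le0$, or there are $v\in\mathcal{F}(x)$ and $c\in\mathcal{V}(x)$ with $c^\top v\ge0$. Learning algorithm: start with $X_0=\emptyset$. For $k=0,1,\ldots$: compute a solution $V_k$ of the learner problem for $X_k$ (if none exists, stop and output FAIL); compute a solution $x_k$ of the verifier problem for $V_k$ (if none exists, stop and output $V_k$); set $\bar x_k=x_k/\|x_k\|$ and $X_{k+1}=X_k\cup\{\bar x_k\}$. For $s>0$ and compact $C\subseteq\mathbb{R}^d$, $\mathrm{Pack}(s;C)$ is the largest cardinality of a subset $\hat C\subseteq C$ such that $\|x-y\|\ge s$ for all distinct $x,y\in\hat C$. Two polyhedral functions $V_1,V_2$ (with sets $\mathcal{V}_1,\mathcal{V}_2$) are $s$-close, $s\ge0$, if for all $c_1\in\mathcal{V}_1$, $\inf_{c_2\in\mathcal{V}_2}\|c_1-c_2\|_*<s$, and for all $c_2\in\mathcal{V}_2$,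 $\inf_{c_1\in\mathcal{V}_1}\|c_1-c_2\|_*<s$.
   Formalization: The bound |Q| Pack(r̄;S) is claimed only if the regions H_q cover R^d (it fails otherwise; termination and the bound N need no covering); the zero function is not counted as a robust Lyapunov function; steps are rounds completed with a counterexample. *)

theory Defs
  imports "HOL-Analysis.Analysis"
begin

definition is_norm :: "(real^'d \<Rightarrow> real) \<Rightarrow> bool" where
  "is_norm nrm \<longleftrightarrow>
     (\<forall>x. 0 \<le> nrm x) \<and> (\<forall>x. nrm x = 0 \<longleftrightarrow> x = 0) \<and>
     (\<forall>a x. nrm (a *\<^sub>R x) = \<bar>a\<bar> * nrm x) \<and>
     (\<forall>x y. nrm (x + y) \<le> nrm x + nrm y)"

definition unit_sphere :: "(real^'d \<Rightarrow> real) \<Rightarrow> (real^'d) set" where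
  "unit_sphere nrm = {x. nrm x = 1}"

(* The unit sphere of a norm on real^'d is compact and non-empty, so the next two suprema
   are maxima. *)

definition dual_norm :: "(real^'d \<Rightarrow> real) \<Rightarrow> real^'d \<Rightarrow> real" where
  "dual_norm nrm c = (SUP x\<in>unit_sphere nrm. c \<bullet> x)"

definition matrix_norm :: "(real^'d \<Rightarrow> real) \<Rightarrow> real^'d^'d \<Rightarrow> real" where
  "matrix_norm nrm A = (SUP x\<in>unit_sphere nrm. nrm (A *v x))"

(* A polyhedron is closed.  The regions are not required to cover the space. *)
definition pwl_system :: "'q set \<Rightarrow> ('q \<Rightarrow> (real^'d) set) \<Rightarrow> bool" where
  "pwl_system Q H \<longleftrightarrow> finite Q \<and> Q \<noteq> {} \<and> (\<forall>q\<in>Q. polyhedron (H q) \<and> conic (H q))"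

definition pwl_map ::
  "'q set \<Rightarrow> ('q \<Rightarrow> (real^'d) set) \<Rightarrow> ('q \<Rightarrow> real^'d^'d) \<Rightarrow> real^'d \<Rightarrow> (real^'d) set" where
  "pwl_map Q H A x = {A q *v x | q. q \<in> Q \<and> x \<in> H q}"

definition a_max :: "(real^'d \<Rightarrow> real) \<Rightarrow> 'q set \<Rightarrow> ('q \<Rightarrow> real^'d^'d) \<Rightarrow> real" where
  "a_max nrm Q A = (MAX q\<in>Q. matrix_norm nrm (A q))"

(* A polyhedral function is represented by its finite set C of coefficient vectors.  The values
   poly_fun C x and coeff_max nrm C are meaningful only for C \<noteq> {}; the empty set
   arises only as the candidate for an empty witness set, with maximum -\<infinity> by
   convention, and is treated explicitly below. *)

definition poly_fun :: "(real^'d) set \<Rightarrow> real^'d \<Rightarrow> real" where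
  "poly_fun C x = (MAX c\<in>C. c \<bullet> x)"

definition active :: "(real^'d) set \<Rightarrow> real^'d \<Rightarrow> (real^'d) set" where
  "active C x = {c\<in>C. c \<bullet> x = poly_fun C x}"

definition coeff_max :: "(real^'d \<Rightarrow> real) \<Rightarrow> (real^'d) set \<Rightarrow> real" where
  "coeff_max nrm C = (MAX c\<in>C. dual_norm nrm c)"

definition dini :: "(real^'d \<Rightarrow> real) \<Rightarrow> real^'d \<Rightarrow> real^'d \<Rightarrow> ereal" where
  "dini f x v = Limsup (at_right 0) (\<lambda>s. ereal ((f (x + s *\<^sub>R v) - f x) / s))"

definition lyapunov ::
  "(real^'d \<Rightarrow> real) \<Rightarrow> (real^'d \<Rightarrow> (real^'d) set) \<Rightarrow> (real^'d \<Rightarrow> real) \<Rightarrow> bool" where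
  "lyapunov nrm F V \<longleftrightarrow>
     continuous_on UNIV V \<and> (\<forall>x. 0 \<le> V x) \<and> (\<forall>x. V x = 0 \<longleftrightarrow> x = 0) \<and>
     filterlim (\<lambda>r. INF x\<in>{x. r \<le> nrm x}. V x) at_top at_top \<and>
     (\<forall>x v. x \<noteq> 0 \<longrightarrow> v \<in> F x \<longrightarrow> dini V x v < 0)"

(* C = {0}, i.e. the zero function, satisfies the two inequalities below for every F, although it
   is not a Lyapunov function; it is excluded. *)
definition robust_lyapunov ::
  "(real^'d \<Rightarrow> real) \<Rightarrow> (real^'d \<Rightarrow> (real^'d) set) \<Rightarrow> real \<Rightarrow> real \<Rightarrow> real \<Rightarrow> (real^'d) set \<Rightarrow> bool"
  where
  "robust_lyapunov nrm F \<epsilon> \<theta> \<delta> C \<longleftrightarrow>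
     finite C \<and> C \<noteq> {} \<and> C \<noteq> {0} \<and>
     (\<forall>x. poly_fun C x \<ge> 1 / \<epsilon> * coeff_max nrm C * nrm x) \<and>
     (\<forall>x. \<forall>v\<in>F x. \<forall>c\<in>C.
        c \<bullet> v \<le> 1 / \<theta> * (poly_fun C x - c \<bullet> x) - \<delta> * coeff_max nrm C * nrm x)"

definition learner_solution ::
  "(real^'d \<Rightarrow> real) \<Rightarrow> (real^'d \<Rightarrow> (real^'d) set) \<Rightarrow> real \<Rightarrow> real \<Rightarrow> real \<Rightarrow>
   (real^'d) set \<Rightarrow> (real^'d) set \<Rightarrow> bool" where
  "learner_solution nrm F \<epsilon> \<theta> \<delta> X C \<longleftrightarrow>
     (\<exists>w. C = w ` X \<and> (\<forall>c\<in>C. dual_norm nrm c \<le> 1) \<and>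
        (\<forall>x\<in>X. w x \<bullet> x \<ge> 1 / \<epsilon> * nrm x \<and>
           (\<forall>v\<in>F x. \<forall>c\<in>C. c \<bullet> v \<le> 1 / \<theta> * (w x \<bullet> x - c \<bullet> x) - \<delta> * nrm x)))"

(* The disjunct C = {} is the case poly_fun C x = -\<infinity> \<le> 0. *)
definition verifier_solution ::
  "(real^'d \<Rightarrow> (real^'d) set) \<Rightarrow> (real^'d) set \<Rightarrow> real^'d \<Rightarrow> bool" where
  "verifier_solution F C x \<longleftrightarrow>
     x \<noteq> 0 \<and> (C = {} \<or> poly_fun C x \<le> 0 \<or> (\<exists>v\<in>F x. \<exists>c\<in>active C x. c \<bullet> v \<ge> 0))"

(* The first n rounds of a run, each completed with a learner solution V k and a counterexample
   x k.  Both may be chosen arbitrarily among the solutions of their problem. *)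
definition execution ::
  "(real^'d \<Rightarrow> real) \<Rightarrow> (real^'d \<Rightarrow> (real^'d) set) \<Rightarrow> real \<Rightarrow> real \<Rightarrow> real \<Rightarrow> nat \<Rightarrow>
   (nat \<Rightarrow> (real^'d) set) \<Rightarrow> (nat \<Rightarrow> (real^'d) set) \<Rightarrow> (nat \<Rightarrow> real^'d) \<Rightarrow> bool" where
  "execution nrm F \<epsilon> \<theta> \<delta> n X V x \<longleftrightarrow>
     X 0 = {} \<and>
     (\<forall>k<n. learner_solution nrm F \<epsilon> \<theta> \<delta> (X k) (V k) \<and>
            verifier_solution F (V k) (x k) \<and>
            X (Suc k) = X k \<union> {x k /\<^sub>R nrm (x k)})"

datatype 'v outcome = Fail | Output "'v set"

definition halts ::
  "(real^'d \<Rightarrow> real) \<Rightarrow> (real^'d \<Rightarrow> (real^'d) set) \<Rightarrow> real \<Rightarrow> real \<Rightarrow> real \<Rightarrow>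
   nat \<Rightarrow> (real^'d) outcome \<Rightarrow> bool" where
  "halts nrm F \<epsilon> \<theta> \<delta> n out \<longleftrightarrow>
     (\<exists>X V x. execution nrm F \<epsilon> \<theta> \<delta> n X V x \<and>
        (case out of
           Fail \<Rightarrow> \<not> (\<exists>C. learner_solution nrm F \<epsilon> \<theta> \<delta> (X n) C)
         | Output C \<Rightarrow> learner_solution nrm F \<epsilon> \<theta> \<delta> (X n) C \<and> \<not> (\<exists>y. verifier_solution F C y)))"

definition Pack :: "(real^'d \<Rightarrow> real) \<Rightarrow> real \<Rightarrow> (real^'d) set \<Rightarrow> enat" where
  "Pack nrm s C =
     (SUP P\<in>{P. finite P \<and> P \<subseteq> C \<and> pairwise (\<lambda>x y. nrm (x - y) \<ge> s) P}. enat (card P))"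

(* The infima are taken in ereal, so that an infimum over the empty set is \<infinity>. *)
definition s_close :: "(real^'d \<Rightarrow> real) \<Rightarrow> real \<Rightarrow> (real^'d) set \<Rightarrow> (real^'d) set \<Rightarrow> bool" where
  "s_close nrm s C1 C2 \<longleftrightarrow>
     (\<forall>c1\<in>C1. (INF c2\<in>C2. ereal (dual_norm nrm (c1 - c2))) < ereal s) \<and>
     (\<forall>c2\<in>C2. (INF c1\<in>C1. ereal (dual_norm nrm (c1 - c2))) < ereal s)"

definition max_nonclose ::
  "(real^'d \<Rightarrow> real) \<Rightarrow> (real^'d \<Rightarrow> (real^'d) set) \<Rightarrow> real \<Rightarrow> real \<Rightarrow> real \<Rightarrow> real \<Rightarrow> enat" where
  "max_nonclose nrm F \<epsilon> \<theta> \<delta> s =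
     (SUP S\<in>{S. finite S \<and>
                (\<forall>C\<in>S. \<exists>X. finite X \<and> X \<subseteq> unit_sphere nrm \<and> learner_solution nrm F \<epsilon> \<theta> \<delta> X C) \<and>
                pairwise (\<lambda>C1 C2. \<not> s_close nrm s C1 C2) S}. enat (card S))"

end

theory Submission
  imports Defs
begin

text \<open>The constraints that the learner imposes at a witness hold with margins: \<open>1 / \<epsilon>\<close> for the value
  and \<open>\<delta>\<close> for the decrease along the flow. The radius \<open>r\<close> is chosen so small that these margins
  survive a perturbation of size less than \<open>r\<close>, of the point or of the coefficients
  (\<open>learner_margins_absorb\<close>). Now let \<open>i < j\<close> be two rounds. The counterexample to candidate \<open>i\<close> is
  a witness for candidate \<open>j\<close>, which therefore satisfies the constraints there with a margin.

  If candidate \<open>i\<close> were \<open>r\<close>-close to candidate \<open>j\<close>, it would satisfy the weaker conditions of the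
  verifier at that point, although it is refuted there. So the candidates of a run are pairwise
  not close, which gives the bound \<open>N\<close> (\<open>run_le_max_nonclose\<close>).

  If the counterexample of round \<open>j\<close> were within \<open>r\<close> of that of round \<open>i\<close>, candidate \<open>j\<close> would be
  positive there, and it would decrease along the flow of every mode whose region contains both
  points. When the regions cover the space, each counterexample can be blamed on one mode, and
  those blamed on the same mode form a packing of the unit sphere (\<open>run_le_modes_times_Pack\<close>). In
  general, a counterexample outside all regions violates positivity, so these are apart as well;
  since the sphere is compact, an infinite run is impossible (\<open>no_infinite_run\<close>).

  For correctness, a robust Lyapunov function, normalized to coefficients of dual norm at most
  one, restricts to a solution of every learner problem (\<open>robust_lyapunov_solves_learner\<close>).
  Conversely, a candidate that the verifier cannot refute is positive away from the origin, and
  each of its active pieces strictly decreases along the flow; homogeneity and finiteness of the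
  set of pieces give radial unboundedness and a negative Dini derivative
  (\<open>unrefuted_candidate_lyapunov\<close>).\<close>

section \<open>Norms on a finite-dimensional space\<close>

locale vector_norm =
  fixes nrm :: "real^'d \<Rightarrow> real"
  assumes is_norm: "is_norm nrm"
begin

lemma nrm_nonneg: "0 \<le> nrm x"
  and nrm_eq_0: "nrm x = 0 \<longleftrightarrow> x = 0"
  and nrm_scale: "nrm (a *\<^sub>R x) = \<bar>a\<bar> * nrm x"
  and nrm_triangle: "nrm (x + y) \<le> nrm x + nrm y"
  using is_norm unfolding is_norm_def by blast+

lemma nrm_minus: "nrm (- x) = nrm x"
  using nrm_scale[of "-1" x] by simp

lemma nrm_pos: "x \<noteq> 0 \<Longrightarrow> 0 < nrm x"
  using nrm_nonneg[of x] nrm_eq_0[of x] by linarith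

lemma nrm_normalized: "x \<noteq> 0 \<Longrightarrow> nrm (x /\<^sub>R nrm x) = 1"
  using nrm_pos[of x] by (simp add: nrm_scale)

lemma nrm_minus_commute: "nrm (x - y) = nrm (y - x)"
  using nrm_minus[of "x - y"] by simp

lemma unit_sphere_nonempty: "unit_sphere nrm \<noteq> {}"
proof -
  have "axis undefined 1 \<noteq> (0 :: real^'d)"
    by (simp add: axis_eq_0_iff)
  then show ?thesis
    using nrm_normalized unfolding unit_sphere_def by blast
qed

lemma continuous_on_nrm: "continuous_on S nrm"
proof -
  have "convex_on UNIV nrm"
  proof (rule convex_onI)
    fix t :: real and x y :: "real^'d"
    assume "0 < t" "t < 1"
    then show "nrm ((1 - t) *\<^sub>R x + t *\<^sub>R y) \<le> (1 - t) * nrm x + t * nrm y"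
      using nrm_triangle[of "(1 - t) *\<^sub>R x" "t *\<^sub>R y"] by (simp add: nrm_scale)
  qed simp
  then have "continuous_on UNIV nrm"
    using convex_on_continuous[of UNIV nrm] by simp
  then show ?thesis
    using continuous_on_subset by blast
qed

text \<open>By homogeneity, the minimum of the norm on the compact Euclidean unit sphere bounds the
  Euclidean norm of the points of the unit sphere of \<open>nrm\<close>.\<close>

lemma compact_unit_sphere: "compact (unit_sphere nrm)"
proof -
  have "sphere (0 :: real^'d) 1 \<noteq> {}"
    by simp
  then obtain z where z: "z \<in> sphere (0 :: real^'d) 1" "\<And>u. u \<in> sphere 0 1 \<Longrightarrow> nrm z \<le> nrm u"
    using continuous_attains_inf[OF compact_sphere _ continuous_on_nrm] by metis
  have "z \<noteq> 0"
    using z(1) by auto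
  have "norm x \<le> 1 / nrm z" if "nrm x = 1" for x
  proof -
    have "x \<noteq> 0"
      using that nrm_eq_0[of x] by auto
    then have "nrm z \<le> nrm (x /\<^sub>R norm x)"
      by (intro z(2)) simp
    also have "\<dots> = 1 / norm x"
      using that by (simp add: nrm_scale divide_inverse)
    finally show ?thesis
      using \<open>x \<noteq> 0\<close> nrm_pos[OF \<open>z \<noteq> 0\<close>] by (simp add: field_simps)
  qed
  then have "bounded (unit_sphere nrm)"
    unfolding unit_sphere_def bounded_iff by blast
  moreover have "closed (unit_sphere nrm)"
    unfolding unit_sphere_def
    by (rule closed_Collect_eq) (auto intro: continuous_on_nrm)
  ultimately show ?thesis
    by (simp add: compact_eq_bounded_closed)
qed

lemma homogeneous_le_SUP:
  fixes f :: "real^'d \<Rightarrow> real"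
  assumes "continuous_on (unit_sphere nrm) f"
    and scale: "\<And>a x. 0 \<le> a \<Longrightarrow> f (a *\<^sub>R x) = a * f x"
  shows "f x \<le> (SUP u\<in>unit_sphere nrm. f u) * nrm x"
proof (cases "x = 0")
  case True
  then show ?thesis
    using scale[of 0 x] nrm_eq_0[of x] by simp
next
  case False
  have "compact (f ` unit_sphere nrm)"
    using assms(1) compact_unit_sphere compact_continuous_image by blast
  then have bdd: "bdd_above (f ` unit_sphere nrm)"
    by (intro bounded_imp_bdd_above compact_imp_bounded)
  have "x /\<^sub>R nrm x \<in> unit_sphere nrm"
    using nrm_normalized[OF False] by (simp add: unit_sphere_def)
  then have "f (x /\<^sub>R nrm x) \<le> (SUP u\<in>unit_sphere nrm. f u)"
    using bdd by (rule cSUP_upper)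
  then have "f x / nrm x \<le> (SUP u\<in>unit_sphere nrm. f u)"
    using nrm_nonneg[of x] scale[of "inverse (nrm x)" x] by (simp add: divide_inverse mult.commute)
  then show ?thesis
    using nrm_pos[OF False] by (simp add: pos_divide_le_eq)
qed

lemma inner_le_dual_norm: "c \<bullet> x \<le> dual_norm nrm c * nrm x"
  unfolding dual_norm_def
  by (rule homogeneous_le_SUP) (auto intro!: continuous_intros)

lemma nrm_matrix_vector_le: "nrm (M *v x) \<le> matrix_norm nrm M * nrm x"
  unfolding matrix_norm_def
proof (rule homogeneous_le_SUP)
  show "continuous_on (unit_sphere nrm) (\<lambda>x. nrm (M *v x))"
    by (rule continuous_on_compose2[OF continuous_on_nrm[of UNIV]])
      (auto intro: linear_continuous_on matrix_vector_mul_bounded_linear)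
  show "nrm (M *v (a *\<^sub>R x)) = a * nrm (M *v x)" if "0 \<le> a" for a x
    using that by (simp add: matrix_vector_mult_scaleR nrm_scale)
qed

lemma abs_inner_le_dual_norm: "\<bar>c \<bullet> x\<bar> \<le> dual_norm nrm c * nrm x"
  using inner_le_dual_norm[of c x] inner_le_dual_norm[of c "- x"] by (simp add: nrm_minus)

lemma dual_norm_nonneg: "0 \<le> dual_norm nrm c"
proof -
  obtain u where "nrm u = 1"
    using unit_sphere_nonempty unfolding unit_sphere_def by blast
  then show ?thesis
    using abs_inner_le_dual_norm[of c u] by simp
qed

lemma matrix_norm_nonneg: "0 \<le> matrix_norm nrm M"
proof -
  obtain u where "nrm u = 1"
    using unit_sphere_nonempty unfolding unit_sphere_def by blast
  then show ?thesis
    using nrm_matrix_vector_le[of M u] nrm_nonneg[of "M *v u"] by simp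
qed

lemma dual_norm_scale:
  assumes "0 \<le> a"
  shows "dual_norm nrm (a *\<^sub>R c) \<le> a * dual_norm nrm c"
  unfolding dual_norm_def[of _ "a *\<^sub>R c"]
proof (rule cSUP_least)
  show "unit_sphere nrm \<noteq> {}"
    by (rule unit_sphere_nonempty)
  show "a *\<^sub>R c \<bullet> u \<le> a * dual_norm nrm c" if "u \<in> unit_sphere nrm" for u
    using that assms inner_le_dual_norm[of c u]
    by (simp add: unit_sphere_def mult_left_mono)
qed

lemma dual_norm_0: "dual_norm nrm 0 = 0"
  using dual_norm_scale[of 0 0] dual_norm_nonneg[of 0] by simp

lemma dual_norm_pos:
  assumes "c \<noteq> 0"
  shows "0 < dual_norm nrm c"
proof -
  have "0 < dual_norm nrm c * nrm c"
    using assms inner_le_dual_norm[of c c] by (smt (verit) inner_gt_zero_iff)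
  then show ?thesis
    using nrm_nonneg[of c] by (simp add: zero_less_mult_iff)
qed

lemma dual_norm_minus_commute: "dual_norm nrm (c - c') = dual_norm nrm (c' - c)"
proof -
  have "dual_norm nrm (- e) \<le> dual_norm nrm e" for e
    unfolding dual_norm_def[of _ "- e"]
  proof (rule cSUP_least)
    show "unit_sphere nrm \<noteq> {}"
      by (rule unit_sphere_nonempty)
    show "- e \<bullet> u \<le> dual_norm nrm e" if "u \<in> unit_sphere nrm" for u
      using that abs_inner_le_dual_norm[of e u] by (simp add: unit_sphere_def)
  qed
  from this[of "c - c'"] this[of "c' - c"] show ?thesis
    by simp
qed

lemma s_close_iff:
  "s_close nrm s C D \<longleftrightarrow>
     (\<forall>c\<in>C. \<exists>d\<in>D. dual_norm nrm (c - d) < s) \<and> (\<forall>d\<in>D. \<exists>c\<in>C. dual_norm nrm (c - d) < s)"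
  unfolding s_close_def by (simp add: INF_less_iff)

lemma s_close_sym: "s_close nrm s C D \<Longrightarrow> s_close nrm s D C"
  unfolding s_close_iff using dual_norm_minus_commute by metis

lemma s_close_refl: "0 < s \<Longrightarrow> s_close nrm s C C"
  unfolding s_close_iff by (metis diff_self dual_norm_0)

end


section \<open>Polyhedral functions\<close>

lemma inner_le_poly_fun: "finite C \<Longrightarrow> c \<in> C \<Longrightarrow> c \<bullet> x \<le> poly_fun C x"
  unfolding poly_fun_def by (auto intro: Max_ge)

lemma poly_fun_attained:
  assumes "finite C" "C \<noteq> {}"
  obtains c where "c \<in> C" "c \<bullet> x = poly_fun C x"
proof -
  have "poly_fun C x \<in> (\<lambda>c. c \<bullet> x) ` C"
    unfolding poly_fun_def using assms by (intro Max_in) auto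
  then show ?thesis
    using that by auto
qed

lemma poly_fun_scale:
  assumes "finite C" "C \<noteq> {}" "0 \<le> a"
  shows "poly_fun C (a *\<^sub>R x) = a * poly_fun C x"
proof -
  have "a * poly_fun C x = Max ((\<lambda>t. a * t) ` (\<lambda>c. c \<bullet> x) ` C)"
    unfolding poly_fun_def using assms
    by (intro mono_Max_commute) (auto intro: monoI mult_left_mono)
  then show ?thesis
    unfolding poly_fun_def by (simp add: image_image)
qed

lemma active_scale:
  assumes "finite C" "0 < a"
  shows "active C (a *\<^sub>R x) = active C x"
proof (cases "C = {}")
  case False
  then show ?thesis
    using assms poly_fun_scale[of C a x] by (auto simp: active_def)
qed (simp add: active_def)

lemma continuous_on_poly_fun:
  assumes "finite C" "C \<noteq> {}"
  shows "continuous_on S (poly_fun C)"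
  using assms
proof (induction rule: finite_ne_induct)
  case (singleton c)
  then show ?case
    unfolding poly_fun_def by (auto intro!: continuous_intros)
next
  case (insert c C)
  have "poly_fun (insert c C) = (\<lambda>x. max (c \<bullet> x) (poly_fun C x))"
    unfolding poly_fun_def using insert.hyps by (auto simp: fun_eq_iff)
  then show ?case
    using insert.IH by (auto intro!: continuous_intros)
qed

text \<open>For small steps only the pieces active at \<open>x\<close> attain the maximum, so near \<open>x\<close> the difference
  quotient is at most the largest slope of an active piece. This slope is negative, being the
  maximum of finitely many negative numbers, which keeps the upper limit strictly negative.\<close>

lemma dini_poly_fun_neg:
  assumes fin: "finite C" and ne: "C \<noteq> {}"
    and neg: "\<And>c. c \<in> active C x \<Longrightarrow> c \<bullet> v < 0"
  shows "dini (poly_fun C) x v < 0"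
proof -
  define \<eta> where "\<eta> = (MAX c\<in>active C x. c \<bullet> v)"
  have fin': "finite (active C x)"
    using fin by (simp add: active_def)
  have ne': "active C x \<noteq> {}"
    using poly_fun_attained[OF fin ne, of x] by (auto simp: active_def)
  have "\<eta> < 0"
    unfolding \<eta>_def using fin' ne' neg by (subst Max_less_iff) auto
  have piece: "\<forall>\<^sub>F s in at_right 0. c \<bullet> (x + s *\<^sub>R v) \<le> poly_fun C x + s * \<eta>" if "c \<in> C" for c
  proof (cases "c \<in> active C x")
    case True
    then have "c \<bullet> v \<le> \<eta>"
      unfolding \<eta>_def using fin' by (auto intro: Max_ge)
    moreover have "c \<bullet> x = poly_fun C x"
      using True by (simp add: active_def)
    ultimately have "c \<bullet> (x + s *\<^sub>R v) \<le> poly_fun C x + s * \<eta>" if "0 < s" for s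
      using that by (simp add: inner_add_right mult_left_mono)
    then show ?thesis
      using eventually_at_right_less[of "0::real"] by (auto elim: eventually_mono)
  next
    case False
    then have lt: "c \<bullet> x < poly_fun C x"
      using that inner_le_poly_fun[OF fin that, of x] by (auto simp: active_def)
    have "((\<lambda>s. c \<bullet> (x + s *\<^sub>R v) - s * \<eta>) \<longlongrightarrow> c \<bullet> (x + 0 *\<^sub>R v) - 0 * \<eta>) (at_right 0)"
      by (intro tendsto_intros)
    then have "\<forall>\<^sub>F s in at_right 0. c \<bullet> (x + s *\<^sub>R v) - s * \<eta> < poly_fun C x"
      using lt by (intro order_tendstoD(2)) auto
    then show ?thesis
      by (rule eventually_mono) simp
  qed
  have "\<forall>\<^sub>F s in at_right 0. \<forall>c\<in>C. c \<bullet> (x + s *\<^sub>R v) \<le> poly_fun C x + s * \<eta>"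
    using fin piece by (intro eventually_ball_finite) auto
  moreover have "\<forall>\<^sub>F s in at_right (0::real). 0 < s"
    by (rule eventually_at_right_less)
  ultimately have
    "\<forall>\<^sub>F s in at_right 0. ereal ((poly_fun C (x + s *\<^sub>R v) - poly_fun C x) / s) \<le> ereal \<eta>"
  proof eventually_elim
    case (elim s)
    then have "poly_fun C (x + s *\<^sub>R v) \<le> poly_fun C x + s * \<eta>"
      using poly_fun_attained[OF fin ne, of "x + s *\<^sub>R v"] by metis
    then show ?case
      using elim by (simp add: divide_le_eq mult.commute)
  qed
  then have "dini (poly_fun C) x v \<le> ereal \<eta>"
    unfolding dini_def by (rule Limsup_bounded)
  also have "\<dots> < 0"
    using \<open>\<eta> < 0\<close> by simp
  finally show ?thesis .
qed

lemma (in vector_norm) filterlim_radial_INF: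
  assumes "0 < m" and lower: "\<And>x. m * nrm x \<le> f x"
  shows "filterlim (\<lambda>t. INF x\<in>{x. t \<le> nrm x}. f x) at_top at_top"
proof (rule filterlim_at_top_mono)
  show "filterlim (\<lambda>t. m * t) at_top at_top"
    using assms(1) by (intro filterlim_tendsto_pos_mult_at_top[OF tendsto_const _ filterlim_ident])
  show "\<forall>\<^sub>F t in at_top. m * t \<le> (INF x\<in>{x. t \<le> nrm x}. f x)"
  proof (rule always_eventually, rule allI, rule cINF_greatest)
    fix t :: real
    obtain u where "nrm u = 1"
      using unit_sphere_nonempty unfolding unit_sphere_def by blast
    then have "t \<le> nrm (\<bar>t\<bar> *\<^sub>R u)"
      by (simp add: nrm_scale)
    then show "{x. t \<le> nrm x} \<noteq> {}"
      by blast
    show "m * t \<le> f x" if "x \<in> {x. t \<le> nrm x}" for x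
      using that lower[of x] assms(1) by (auto intro: order_trans[OF mult_left_mono])
  qed
qed

text \<open>A positive, positively homogeneous function dominates the norm up to its minimum on the
  compact unit sphere, and this makes it radially unbounded.\<close>

lemma (in vector_norm) lyapunov_poly_funI:
  assumes fin: "finite C" and ne: "C \<noteq> {}"
    and pos: "\<And>x. x \<noteq> 0 \<Longrightarrow> 0 < poly_fun C x"
    and neg: "\<And>x v c. x \<noteq> 0 \<Longrightarrow> v \<in> F x \<Longrightarrow> c \<in> active C x \<Longrightarrow> c \<bullet> v < 0"
  shows "lyapunov nrm F (poly_fun C)"
proof -
  have zero: "poly_fun C 0 = 0"
    using poly_fun_scale[OF fin ne, of 0 0] by simp
  obtain z where z: "z \<in> unit_sphere nrm"
      "\<And>u. u \<in> unit_sphere nrm \<Longrightarrow> poly_fun C z \<le> poly_fun C u"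
    using continuous_attains_inf[OF compact_unit_sphere unit_sphere_nonempty
        continuous_on_poly_fun[OF fin ne]] by metis
  have "z \<noteq> 0"
    using z(1) nrm_eq_0[of z] by (auto simp: unit_sphere_def)
  have lower: "poly_fun C z * nrm x \<le> poly_fun C x" for x
  proof (cases "x = 0")
    case True
    then show ?thesis
      using zero nrm_eq_0[of x] by simp
  next
    case False
    then have "poly_fun C z \<le> poly_fun C (x /\<^sub>R nrm x)"
      using z(2) nrm_normalized by (simp add: unit_sphere_def)
    then have "poly_fun C z \<le> poly_fun C x / nrm x"
      using nrm_nonneg[of x] poly_fun_scale[OF fin ne, of "inverse (nrm x)" x]
      by (simp add: divide_inverse mult.commute)
    then show ?thesis
      using nrm_pos[OF False] by (simp add: pos_le_divide_eq)
  qed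
  have "filterlim (\<lambda>t. INF x\<in>{x. t \<le> nrm x}. poly_fun C x) at_top at_top"
    using pos[OF \<open>z \<noteq> 0\<close>] lower by (rule filterlim_radial_INF)
  moreover have "0 \<le> poly_fun C x" "poly_fun C x = 0 \<longleftrightarrow> x = 0" for x
    using pos[of x] zero by (cases "x = 0"; force)+
  moreover have "dini (poly_fun C) x v < 0" if "x \<noteq> 0" "v \<in> F x" for x v
    using fin ne neg[OF that] by (rule dini_poly_fun_neg)
  ultimately show ?thesis
    unfolding lyapunov_def using continuous_on_poly_fun[OF fin ne] by blast
qed


section \<open>Runs of the learning algorithm\<close>

lemma learner_solution_finite: "finite X \<Longrightarrow> learner_solution nrm F \<epsilon> \<theta> \<delta> X C \<Longrightarrow> finite C"
  unfolding learner_solution_def by auto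

lemma execution_witnesses:
  assumes "execution nrm F \<epsilon> \<theta> \<delta> n X V x" "k \<le> n"
  shows "X k = (\<lambda>i. x i /\<^sub>R nrm (x i)) ` {..<k}"
  using assms(2)
proof (induction k)
  case 0
  then show ?case
    using assms(1) by (simp add: execution_def)
next
  case (Suc k)
  then show ?case
    using assms(1) by (auto simp: execution_def lessThan_Suc)
qed

locale pwl_learning = vector_norm nrm
  for nrm :: "real^'d \<Rightarrow> real" +
  fixes Q :: "'q set" and H :: "'q \<Rightarrow> (real^'d) set" and A :: "'q \<Rightarrow> real^'d^'d"
    and F :: "real^'d \<Rightarrow> (real^'d) set" and \<epsilon> \<theta> \<delta> r :: real
  assumes system: "pwl_system Q H"
    and F_def: "F = pwl_map Q H A"
    and eps: "\<epsilon> \<ge> 1" and theta: "\<theta> > 0" and delta: "\<delta> > 0"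
    and r_def: "r = min (1 / \<epsilon>) (\<theta> * \<delta> / (2 + \<theta> * a_max nrm Q A))"
begin

lemma finite_modes: "finite Q"
  using system by (simp add: pwl_system_def)

lemma matrix_norm_le_a_max: "q \<in> Q \<Longrightarrow> matrix_norm nrm (A q) \<le> a_max nrm Q A"
  unfolding a_max_def using finite_modes by (auto intro: Max_ge)

lemma a_max_nonneg: "0 \<le> a_max nrm Q A"
proof -
  obtain q where "q \<in> Q"
    using system by (auto simp: pwl_system_def)
  then show ?thesis
    using matrix_norm_le_a_max matrix_norm_nonneg[of "A q"] by force
qed

lemma mode_nrm_le: "q \<in> Q \<Longrightarrow> nrm (A q *v x) \<le> a_max nrm Q A * nrm x"
  using nrm_matrix_vector_le[of "A q" x] matrix_norm_le_a_max[of q] nrm_nonneg[of x]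
  by (meson mult_right_mono order_trans)

lemma flow_nrm_le: "v \<in> F x \<Longrightarrow> nrm v \<le> a_max nrm Q A * nrm x"
  unfolding F_def pwl_map_def using mode_nrm_le by auto

lemma r_le: "r \<le> 1 / \<epsilon>" "r * (2 + \<theta> * a_max nrm Q A) \<le> \<theta> * \<delta>"
  and r_pos: "0 < r"
proof -
  have den: "0 < 2 + \<theta> * a_max nrm Q A"
    using theta a_max_nonneg by (simp add: add_pos_nonneg)
  show "r \<le> 1 / \<epsilon>"
    by (simp add: r_def)
  have "r \<le> \<theta> * \<delta> / (2 + \<theta> * a_max nrm Q A)"
    by (simp add: r_def)
  then show "r * (2 + \<theta> * a_max nrm Q A) \<le> \<theta> * \<delta>"
    using den by (simp add: pos_le_divide_eq)
  show "0 < r"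
    unfolding r_def using den eps theta delta by simp
qed

lemma flow_scale:
  assumes "v \<in> F x" "0 < a"
  shows "a *\<^sub>R v \<in> F (a *\<^sub>R x)"
proof -
  obtain q where q: "q \<in> Q" "x \<in> H q" "v = A q *v x"
    using assms(1) unfolding F_def pwl_map_def by blast
  moreover have "a *\<^sub>R x \<in> H q"
    using system q assms(2) by (simp add: pwl_system_def conic_def)
  ultimately show ?thesis
    unfolding F_def pwl_map_def by (auto simp: matrix_vector_mult_scaleR)
qed

lemma verifier_solution_scale:
  assumes "verifier_solution F C x" "finite C" "0 < a"
  shows "verifier_solution F C (a *\<^sub>R x)"
proof (cases "C = {}")
  case True
  then show ?thesis
    using assms by (simp add: verifier_solution_def)
next
  case False
  have "poly_fun C (a *\<^sub>R x) \<le> 0" if "poly_fun C x \<le> 0"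
  proof -
    have "a * poly_fun C x \<le> 0"
      using that assms(3) by (simp add: mult_le_0_iff)
    then show ?thesis
      using poly_fun_scale[OF assms(2) False, of a x] assms(3) by simp
  qed
  moreover have "\<exists>v\<in>F (a *\<^sub>R x). \<exists>c\<in>active C (a *\<^sub>R x). 0 \<le> c \<bullet> v"
    if "v \<in> F x" "c \<in> active C x" "0 \<le> c \<bullet> v" for v c
  proof -
    have "a *\<^sub>R v \<in> F (a *\<^sub>R x)"
      using that(1) assms(3) by (rule flow_scale)
    moreover have "c \<in> active C (a *\<^sub>R x)"
      using that(2) active_scale[OF assms(2,3)] by simp
    moreover have "0 \<le> c \<bullet> a *\<^sub>R v"
      using that(3) assms(3) by simp
    ultimately show ?thesis
      by blast
  qed
  ultimately show ?thesis
    using assms(1,3) False unfolding verifier_solution_def by (metis less_irrefl scaleR_eq_0_iff)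
qed

text \<open>The learner constraints at a unit witness \<open>x\<close> leave the margins \<open>1 / \<epsilon>\<close> on the value and \<open>\<delta>\<close>
  on the decrease. Pass from \<open>C\<close> at \<open>x\<close> to \<open>D\<close> at \<open>y\<close> in such a way that values change by less than
  \<open>r\<close> and slopes by at most \<open>r * a_max\<close>. The value then stays above \<open>1 / \<epsilon> - r \<ge> 0\<close>; the decrease
  bound loses \<open>r * a_max\<close> from the slope and \<open>2 * r / \<theta>\<close> from the gap between two values, which is
  at most \<open>\<delta>\<close> in total. So \<open>y\<close> refutes \<open>D\<close> neither by its value nor by its slope. This carries both
  iteration bounds, once with \<open>x = y\<close> and once with \<open>C = D\<close>.\<close>

lemma learner_margins_absorb:
  assumes sol: "learner_solution nrm F \<epsilon> \<theta> \<delta> X C" and "x \<in> X" and "nrm x = 1" and "finite D"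
    and val: "\<forall>c\<in>C. \<exists>d\<in>D. c \<bullet> x < d \<bullet> y + r"
  shows "D \<noteq> {}" and "0 < poly_fun D y"
    and "\<lbrakk>d \<in> active D y; c \<in> C; v' \<in> F x; d \<bullet> y < c \<bullet> x + r; d \<bullet> v \<le> c \<bullet> v' + r * a_max nrm Q A\<rbrakk>
      \<Longrightarrow> d \<bullet> v < 0"
proof -
  obtain w where w: "C = w ` X" "1 / \<epsilon> \<le> w x \<bullet> x"
    and dec: "\<And>v c. v \<in> F x \<Longrightarrow> c \<in> C \<Longrightarrow> c \<bullet> v \<le> 1 / \<theta> * (w x \<bullet> x - c \<bullet> x) - \<delta>"
    using sol assms(2,3) unfolding learner_solution_def by (metis mult.right_neutral)
  obtain d0 where d0: "d0 \<in> D" "w x \<bullet> x < d0 \<bullet> y + r"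
    using val w(1) assms(2) by blast
  have top: "d0 \<bullet> y \<le> poly_fun D y"
    using assms(4) d0(1) by (rule inner_le_poly_fun)
  show "D \<noteq> {}"
    using d0 by blast
  show "0 < poly_fun D y"
    using d0 w(2) top r_le(1) by linarith
  assume d: "d \<in> active D y" "c \<in> C" "v' \<in> F x" "d \<bullet> y < c \<bullet> x + r"
    "d \<bullet> v \<le> c \<bullet> v' + r * a_max nrm Q A"
  have "w x \<bullet> x - c \<bullet> x < 2 * r"
    using d d0 top by (simp add: active_def)
  then have "1 / \<theta> * (w x \<bullet> x - c \<bullet> x) < 1 / \<theta> * (2 * r)"
    using theta by (intro mult_strict_left_mono) auto
  moreover have "1 / \<theta> * (2 * r) + r * a_max nrm Q A \<le> \<delta>"
    using r_le(2) theta by (simp add: field_simps)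
  ultimately show "d \<bullet> v < 0"
    using dec[OF d(3,2)] d(5) by linarith
qed

context
  fixes n :: nat and X V :: "nat \<Rightarrow> (real^'d) set" and x xb :: "nat \<Rightarrow> real^'d"
  assumes run: "execution nrm F \<epsilon> \<theta> \<delta> n X V x"
    and xb_def: "xb = (\<lambda>i. x i /\<^sub>R nrm (x i))"
begin

lemma run_learner: "k < n \<Longrightarrow> learner_solution nrm F \<epsilon> \<theta> \<delta> (X k) (V k)"
  using run by (simp add: execution_def)

lemma run_witnesses: "k \<le> n \<Longrightarrow> X k = xb ` {..<k}"
  unfolding xb_def using run by (rule execution_witnesses)

lemma run_finite: "k < n \<Longrightarrow> finite (V k)"
  using learner_solution_finite[OF _ run_learner] run_witnesses[of k] by simp

lemma run_unit: "k < n \<Longrightarrow> nrm (xb k) = 1"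
  using run unfolding xb_def by (simp add: execution_def verifier_solution_def nrm_normalized)

lemma run_counterexample:
  assumes "k < n"
  shows "verifier_solution F (V k) (xb k)"
proof -
  have "verifier_solution F (V k) (x k)"
    using run assms by (simp add: execution_def)
  moreover have "0 < inverse (nrm (x k))"
    using calculation by (simp add: verifier_solution_def nrm_pos)
  ultimately show ?thesis
    unfolding xb_def using run_finite[OF assms] by (intro verifier_solution_scale)
qed

text \<open>The later candidate satisfies the constraints at the earlier counterexample. A candidate
  close to it inherits them up to the margins, so it is not the one refuted there.\<close>

lemma run_candidates_not_close:
  assumes "i < j" "j < n"
  shows "\<not> s_close nrm r (V i) (V j)"
proof
  assume close: "s_close nrm r (V i) (V j)"
  have i: "i < n" and mem: "xb i \<in> X j"
    using assms run_witnesses[of j] by auto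
  have near: "\<bar>d \<bullet> u - c \<bullet> u\<bar> \<le> dual_norm nrm (d - c) * nrm u" for d c u
    using abs_inner_le_dual_norm[of "d - c" u] by (simp add: inner_diff_left)
  have "\<forall>c\<in>V j. \<exists>d\<in>V i. c \<bullet> xb i < d \<bullet> xb i + r"
  proof
    fix c
    assume c: "c \<in> V j"
    then obtain d where "d \<in> V i" "dual_norm nrm (d - c) < r"
      using close unfolding s_close_iff by blast
    then show "\<exists>d\<in>V i. c \<bullet> xb i < d \<bullet> xb i + r"
      using near[of d "xb i" c] run_unit[OF i] by (intro bexI[of _ d]) auto
  qed
  note absorb = learner_margins_absorb[OF run_learner[OF assms(2)] mem run_unit[OF i]
      run_finite[OF i] this]
  obtain v d where v: "v \<in> F (xb i)" and d: "d \<in> active (V i) (xb i)" "0 \<le> d \<bullet> v"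
    using run_counterexample[OF i] absorb(1,2) unfolding verifier_solution_def by force
  obtain c where c: "c \<in> V j" "dual_norm nrm (d - c) < r"
    using close d(1) unfolding s_close_iff active_def by blast
  have "d \<bullet> xb i < c \<bullet> xb i + r"
    using c(2) near[of d "xb i" c] run_unit[OF i] by simp
  moreover have "dual_norm nrm (d - c) * nrm v \<le> r * a_max nrm Q A"
    using c(2) flow_nrm_le[OF v] run_unit[OF i] r_pos nrm_nonneg[of v]
    by (intro mult_mono) auto
  then have "d \<bullet> v \<le> c \<bullet> v + r * a_max nrm Q A"
    using near[of d v c] by linarith
  ultimately show False
    using absorb(3)[OF d(1) c(1) v] d(2) by force
qed

end

text \<open>A label for the reason why \<open>y\<close> refutes \<open>C\<close>. A violation of the slope condition is blamed on
  the mode that causes it. A violation of the value condition may be blamed on any mode whose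
  region contains \<open>y\<close>, so that modes suffice as labels if the regions cover the space, and on
  \<open>None\<close>, which serves for a point outside all regions.\<close>

definition blames :: "(real^'d) set \<Rightarrow> real^'d \<Rightarrow> 'q option \<Rightarrow> bool" where
  "blames C y m \<longleftrightarrow>
     (case m of
        None \<Rightarrow> C = {} \<or> poly_fun C y \<le> 0
      | Some q \<Rightarrow> q \<in> Q \<and> y \<in> H q \<and>
          (C = {} \<or> poly_fun C y \<le> 0 \<or> (\<exists>c\<in>active C y. 0 \<le> c \<bullet> (A q *v y))))"

lemma ex_blames: "verifier_solution F C y \<Longrightarrow> \<exists>m. blames C y m"
  and ex_blames_mode:
    "verifier_solution F C y \<Longrightarrow> (\<Union>q\<in>Q. H q) = UNIV \<Longrightarrow> \<exists>q. blames C y (Some q)"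
proof -
  assume "verifier_solution F C y"
  then consider (val) "C = {} \<or> poly_fun C y \<le> 0"
    | (slope) q c where "q \<in> Q" "y \<in> H q" "c \<in> active C y" "0 \<le> c \<bullet> (A q *v y)"
    unfolding verifier_solution_def F_def pwl_map_def by blast
  note cases = this
  show "\<exists>m. blames C y m"
  proof (cases rule: cases)
    case val
    then have "blames C y None"
      by (simp add: blames_def)
    then show ?thesis ..
  next
    case (slope q c)
    then have "blames C y (Some q)"
      by (auto simp: blames_def)
    then show ?thesis ..
  qed
  assume "(\<Union>q\<in>Q. H q) = UNIV"
  then obtain q where "q \<in> Q" "y \<in> H q"
    by blast
  with cases show "\<exists>q. blames C y (Some q)"
  proof (cases rule: cases)
    case val
    then have "blames C y (Some q)"
      using \<open>q \<in> Q\<close> \<open>y \<in> H q\<close> by (auto simp: blames_def)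
    then show ?thesis ..
  next
    case (slope q' c)
    then have "blames C y (Some q')"
      by (auto simp: blames_def)
    then show ?thesis ..
  qed
qed

text \<open>The later candidate has coefficients of dual norm at most one and satisfies the constraints
  at the earlier counterexample, including those for the blamed mode, if there is one. They
  persist up to the margins at distance less than \<open>r\<close> within the region of that mode, so the later
  counterexample lies farther away.\<close>

lemma run_counterexamples_apart:
  assumes run: "execution nrm F \<epsilon> \<theta> \<delta> n X V x" and "i < j" "j < n"
    and xb: "xb = (\<lambda>i. x i /\<^sub>R nrm (x i))"
    and blame: "blames (V i) (xb i) m" "blames (V j) (xb j) m"
  shows "r \<le> nrm (xb i - xb j)"
proof (rule ccontr)
  assume "\<not> r \<le> nrm (xb i - xb j)"
  then have lt: "nrm (xb i - xb j) < r" "nrm (xb j - xb i) < r"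
    using nrm_minus_commute[of "xb i" "xb j"] by simp_all
  have i: "i < n" and mem: "xb i \<in> X j"
    using assms(2,3) run_witnesses[OF run xb, of j] by auto
  note sol = run_learner[OF run xb assms(3)]
  have dual: "dual_norm nrm c \<le> 1" if "c \<in> V j" for c
    using sol that unfolding learner_solution_def by blast
  have le: "c \<bullet> u \<le> nrm u" if "c \<in> V j" for c u
    using inner_le_dual_norm[of c u] mult_right_mono[OF dual[OF that] nrm_nonneg[of u]] by simp
  have "\<forall>c\<in>V j. \<exists>d\<in>V j. c \<bullet> xb i < d \<bullet> xb j + r"
  proof
    fix c
    assume c: "c \<in> V j"
    then show "\<exists>d\<in>V j. c \<bullet> xb i < d \<bullet> xb j + r"
      using le[OF c, of "xb i - xb j"] lt by (intro bexI[of _ c]) (auto simp: inner_diff_right)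
  qed
  note absorb = learner_margins_absorb[OF sol mem run_unit[OF run xb i]
      run_finite[OF run xb assms(3)] this]
  obtain q where "m = Some q"
    using blame(2) absorb(1,2) by (cases m) (auto simp: blames_def)
  then obtain c where q: "q \<in> Q" "xb i \<in> H q"
    and c: "c \<in> active (V j) (xb j)" "0 \<le> c \<bullet> (A q *v xb j)"
    using blame absorb(1,2) by (auto simp: blames_def)
  have cV: "c \<in> V j"
    using c(1) by (simp add: active_def)
  have flow: "A q *v xb i \<in> F (xb i)"
    unfolding F_def pwl_map_def using q by blast
  have "c \<bullet> xb j < c \<bullet> xb i + r"
    using le[OF cV, of "xb j - xb i"] lt by (simp add: inner_diff_right)
  moreover have "c \<bullet> (A q *v xb j) \<le> c \<bullet> (A q *v xb i) + r * a_max nrm Q A"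
  proof -
    have "c \<bullet> (A q *v xb j) - c \<bullet> (A q *v xb i) \<le> nrm (A q *v (xb j - xb i))"
      using le[OF cV] by (simp add: matrix_vector_mult_diff_distrib flip: inner_diff_right)
    also have "\<dots> \<le> a_max nrm Q A * nrm (xb j - xb i)"
      using q(1) by (rule mode_nrm_le)
    also have "\<dots> \<le> a_max nrm Q A * r"
      using lt(2) a_max_nonneg by (intro mult_left_mono) auto
    finally show ?thesis
      by (simp add: mult.commute)
  qed
  ultimately show False
    using absorb(3)[OF c(1) cV flow] c(2) by force
qed

lemma run_le_max_nonclose:
  assumes run: "execution nrm F \<epsilon> \<theta> \<delta> n X V x"
  shows "enat n \<le> max_nonclose nrm F \<epsilon> \<theta> \<delta> r"
proof -
  define xb where "xb = (\<lambda>i. x i /\<^sub>R nrm (x i))"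
  note run' = run xb_def
  have apart: "\<not> s_close nrm r (V i) (V j)" if "i < n" "j < n" "i \<noteq> j" for i j
    using that run_candidates_not_close[OF run' _ that(1)] run_candidates_not_close[OF run' _ that(2)]
    by (metis linorder_neqE_nat s_close_sym)
  have "inj_on V {..<n}"
    using apart s_close_refl[OF r_pos] by (intro inj_onI) (metis lessThan_iff)
  then have "card (V ` {..<n}) = n"
    by (simp add: card_image)
  moreover have "enat (card (V ` {..<n})) \<le> max_nonclose nrm F \<epsilon> \<theta> \<delta> r"
    unfolding max_nonclose_def
  proof (rule SUP_upper, rule CollectI, intro conjI ballI)
    show "finite (V ` {..<n})"
      by simp
    show "pairwise (\<lambda>C D. \<not> s_close nrm r C D) (V ` {..<n})"
      using apart unfolding pairwise_def by blast
    fix C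
    assume "C \<in> V ` {..<n}"
    then obtain k where k: "k < n" "C = V k"
      by blast
    have "finite (X k)" "X k \<subseteq> unit_sphere nrm"
      using k(1) run_witnesses[OF run', of k] run_unit[OF run'] by (auto simp: unit_sphere_def)
    then show "\<exists>Y. finite Y \<and> Y \<subseteq> unit_sphere nrm \<and> learner_solution nrm F \<epsilon> \<theta> \<delta> Y C"
      using run_learner[OF run' k(1)] k(2) by blast
  qed
  ultimately show ?thesis
    by simp
qed

lemma run_le_modes_times_Pack:
  assumes run: "execution nrm F \<epsilon> \<theta> \<delta> n X V x" and cover: "(\<Union>q\<in>Q. H q) = UNIV"
  shows "enat n \<le> enat (card Q) * Pack nrm r (unit_sphere nrm)"
proof -
  define xb where "xb = (\<lambda>i. x i /\<^sub>R nrm (x i))"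
  note run' = run xb_def
  have "\<forall>k<n. \<exists>q. blames (V k) (xb k) (Some q)"
    using run_counterexample[OF run'] ex_blames_mode cover by blast
  then obtain p where p: "\<And>k. k < n \<Longrightarrow> blames (V k) (xb k) (Some (p k))"
    by metis
  define I where "I q = {k \<in> {..<n}. p k = q}" for q
  have modes: "p ` {..<n} \<subseteq> Q"
    using p by (auto simp: blames_def)
  have packing: "enat (card (I q)) \<le> Pack nrm r (unit_sphere nrm)" for q
  proof -
    have apart: "r \<le> nrm (xb i - xb j)" if ij: "i \<in> I q" "j \<in> I q" "i \<noteq> j" for i j
    proof -
      have *: "i < n" "j < n" "blames (V i) (xb i) (Some q)" "blames (V j) (xb j) (Some q)"
        using ij p[of i] p[of j] unfolding I_def by auto
      show ?thesis
        using ij(3) run_counterexamples_apart[OF run _ *(2) xb_def *(3,4)]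
          run_counterexamples_apart[OF run _ *(1) xb_def *(4,3)] nrm_minus_commute
        by (metis linorder_neqE_nat)
    qed
    have "inj_on xb (I q)"
    proof (rule inj_onI, rule ccontr)
      fix i j
      assume "i \<in> I q" "j \<in> I q" "xb i = xb j" "i \<noteq> j"
      then show False
        using apart[of i j] r_pos nrm_eq_0[of 0] by simp
    qed
    then have "card (I q) = card (xb ` I q)"
      by (simp add: card_image)
    moreover have "pairwise (\<lambda>y z. r \<le> nrm (y - z)) (xb ` I q)"
      using apart by (auto simp: pairwise_def)
    moreover have "finite (xb ` I q)" "xb ` I q \<subseteq> unit_sphere nrm"
      using run_unit[OF run'] by (auto simp: I_def unit_sphere_def)
    ultimately show ?thesis
      unfolding Pack_def by (intro SUP_upper2[of "xb ` I q"]) auto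
  qed
  have "n = (\<Sum>q\<in>Q. card (I q))"
    using sum.group[OF _ finite_modes modes, of "\<lambda>_. 1 :: nat"] by (simp add: I_def)
  then have "enat n = (\<Sum>q\<in>Q. enat (card (I q)))"
    by (simp flip: of_nat_eq_enat of_nat_sum)
  also have "\<dots> \<le> (\<Sum>q\<in>Q. Pack nrm r (unit_sphere nrm))"
    using packing by (intro sum_mono)
  also have "\<dots> = enat (card Q) * Pack nrm r (unit_sphere nrm)"
    by (simp add: of_nat_eq_enat)
  finally show ?thesis .
qed

text \<open>The counterexamples of an infinite run accumulate on the compact unit sphere. Infinitely
  many of them lie within \<open>r\<close> of each other and so carry different labels, but there are only
  finitely many labels.\<close>

lemma no_infinite_run: "\<exists>n. \<not> execution nrm F \<epsilon> \<theta> \<delta> n X V x"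
proof (rule ccontr)
  assume "\<not> ?thesis"
  then have run: "\<And>n. execution nrm F \<epsilon> \<theta> \<delta> n X V x"
    by blast
  define xb where "xb = (\<lambda>i. x i /\<^sub>R nrm (x i))"
  have "\<forall>k. \<exists>m. blames (V k) (xb k) m"
    using run_counterexample[OF run xb_def] ex_blames by blast
  then obtain p where p: "\<And>k. blames (V k) (xb k) (p k)"
    by metis
  have "xb k \<in> unit_sphere nrm" for k
    using run_unit[OF run xb_def, of k "Suc k"] by (simp add: unit_sphere_def)
  then obtain l \<sigma> where \<sigma>: "strict_mono \<sigma>" and lim: "(xb \<circ> \<sigma>) \<longlonglongrightarrow> l"
    using compact_unit_sphere unfolding compact_def by blast
  have "((\<lambda>k. nrm (xb (\<sigma> k) - l)) \<longlongrightarrow> nrm (l - l)) sequentially"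
    using lim by (intro continuous_on_tendsto_compose[OF continuous_on_nrm[of UNIV]] tendsto_intros)
      (auto simp: o_def)
  then have "\<forall>\<^sub>F k in sequentially. nrm (xb (\<sigma> k) - l) < r / 2"
    using r_pos nrm_eq_0[of 0] by (intro order_tendstoD(2)) auto
  then obtain K where K: "\<And>k. K \<le> k \<Longrightarrow> nrm (xb (\<sigma> k) - l) < r / 2"
    unfolding eventually_sequentially by blast
  have close: "nrm (xb (\<sigma> i) - xb (\<sigma> j)) < r" if "K \<le> i" "K \<le> j" for i j
    using K[OF that(1)] K[OF that(2)] nrm_triangle[of "xb (\<sigma> i) - l" "l - xb (\<sigma> j)"]
      nrm_minus_commute[of l "xb (\<sigma> j)"] by simp
  have "p (\<sigma> i) \<noteq> p (\<sigma> j)" if "K \<le> i" "i < j" for i j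
  proof
    assume "p (\<sigma> i) = p (\<sigma> j)"
    moreover have "\<sigma> i < \<sigma> j"
      using \<sigma> that(2) by (rule strict_monoD)
    ultimately have "r \<le> nrm (xb (\<sigma> i) - xb (\<sigma> j))"
      using run_counterexamples_apart[OF run _ lessI xb_def, of "\<sigma> i" "\<sigma> j" "p (\<sigma> i)"] p[of "\<sigma> i"]
        p[of "\<sigma> j"] by simp
    then show False
      using close[of i j] that by simp
  qed
  then have "inj_on (p \<circ> \<sigma>) {K..}"
    by (intro linorder_inj_onI) (auto simp: o_def)
  moreover have "(p \<circ> \<sigma>) ` {K..} \<subseteq> insert None (Some ` Q)"
  proof -
    have "p k \<in> insert None (Some ` Q)" for k
      using p[of k] by (cases "p k") (auto simp: blames_def)
    then show ?thesis
      by (auto simp: o_def)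
  qed
  ultimately have "finite {K..}"
    using finite_modes by (meson finite_imageI finite_insert inj_on_finite)
  then show False
    by (simp add: infinite_Ici)
qed

text \<open>Normalize a robust Lyapunov function to \<open>coeff_max = 1\<close> and let each witness pick an active
  coefficient. The picks attain the values of the function, and the remaining constraints are
  among those of robustness, so any witness set is solved.\<close>

lemma robust_lyapunov_solves_learner:
  assumes "robust_lyapunov nrm F \<epsilon> \<theta> \<delta> C"
  shows "\<exists>D. learner_solution nrm F \<epsilon> \<theta> \<delta> X D"
proof -
  define M where "M = coeff_max nrm C"
  have C: "finite C" "C \<noteq> {}" "C \<noteq> {0}"
    and low: "\<And>y. 1 / \<epsilon> * M * nrm y \<le> poly_fun C y"
    and dec: "\<And>y v c. v \<in> F y \<Longrightarrow> c \<in> C \<Longrightarrow>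
      c \<bullet> v \<le> 1 / \<theta> * (poly_fun C y - c \<bullet> y) - \<delta> * M * nrm y"
    using assms unfolding robust_lyapunov_def M_def by blast+
  have le_M: "dual_norm nrm c \<le> M" if "c \<in> C" for c
    unfolding M_def coeff_max_def using C that by (auto intro: Max_ge)
  obtain c where "c \<in> C" "c \<noteq> 0"
    using C by blast
  then have "0 < M"
    using le_M[of c] dual_norm_pos[of c] by linarith
  have "\<forall>y. \<exists>c. c \<in> C \<and> c \<bullet> y = poly_fun C y"
    using poly_fun_attained[OF C(1,2)] by metis
  then obtain g where g: "\<And>y. g y \<in> C" "\<And>y. g y \<bullet> y = poly_fun C y"
    by metis
  define w where "w y = g y /\<^sub>R M" for y
  have "dual_norm nrm (w y) \<le> 1" for y
    using dual_norm_scale[of "inverse M" "g y"] le_M[OF g(1)[of y]] \<open>0 < M\<close>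
      mult_left_mono[of "dual_norm nrm (g y)" M "inverse M"]
    unfolding w_def by simp
  moreover have "1 / \<epsilon> * nrm y \<le> w y \<bullet> y" for y
    using low[of y] \<open>0 < M\<close> unfolding w_def by (simp add: g(2) field_simps)
  moreover have "w z \<bullet> v \<le> 1 / \<theta> * (w y \<bullet> y - w z \<bullet> y) - \<delta> * nrm y" if "v \<in> F y" for y z v
  proof -
    have "inverse M * (g z \<bullet> v)
        \<le> inverse M * (1 / \<theta> * (g y \<bullet> y - g z \<bullet> y) - \<delta> * M * nrm y)"
      using dec[OF that g(1)[of z]] \<open>0 < M\<close> by (intro mult_left_mono) (auto simp: g(2))
    also have "\<dots> = 1 / \<theta> * (w y \<bullet> y - w z \<bullet> y) - \<delta> * nrm y"
      using \<open>0 < M\<close> theta unfolding w_def by (simp add: field_simps)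
    finally show ?thesis
      unfolding w_def by simp
  qed
  ultimately have "learner_solution nrm F \<epsilon> \<theta> \<delta> X (w ` X)"
    unfolding learner_solution_def by (intro exI[of _ w]) blast
  then show ?thesis ..
qed

lemma unrefuted_candidate_lyapunov:
  assumes "finite C" and none: "\<not> (\<exists>y. verifier_solution F C y)"
  shows "C \<noteq> {}" and "lyapunov nrm F (poly_fun C)"
proof -
  obtain u where "nrm u = 1"
    using unit_sphere_nonempty unfolding unit_sphere_def by blast
  then have "u \<noteq> 0"
    using nrm_eq_0[of u] by auto
  then show ne: "C \<noteq> {}"
    using none unfolding verifier_solution_def by blast
  show "lyapunov nrm F (poly_fun C)"
  proof (rule lyapunov_poly_funI[OF assms(1) ne])
    show "0 < poly_fun C y" if "y \<noteq> 0" for y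
      using that none unfolding verifier_solution_def by force
    show "c \<bullet> v < 0" if "y \<noteq> 0" "v \<in> F y" "c \<in> active C y" for y v c
      using that none unfolding verifier_solution_def by force
  qed
qed

end


section \<open>Termination and correctness of the learning algorithm\<close>

theorem corollary31:
  fixes nrm :: "real^'d \<Rightarrow> real"
    and Q :: "'q set" and H :: "'q \<Rightarrow> (real^'d) set" and A :: "'q \<Rightarrow> real^'d^'d"
    and F :: "real^'d \<Rightarrow> (real^'d) set"
    and \<epsilon> \<theta> \<delta> r :: real and N :: enat
  assumes "is_norm nrm"
    and "pwl_system Q H"
    and "F = pwl_map Q H A"
    and "\<epsilon> \<ge> 1" and "\<theta> > 0" and "\<delta> > 0"
    and "r = min (1 / \<epsilon>) (\<theta> * \<delta> / (2 + \<theta> * a_max nrm Q A))"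
    and "N = max_nonclose nrm F \<epsilon> \<theta> \<delta> r"
  shows
    "\<not> (\<exists>X V x. \<forall>n. execution nrm F \<epsilon> \<theta> \<delta> n X V x) \<and>
     (\<forall>n X V x. execution nrm F \<epsilon> \<theta> \<delta> n X V x \<longrightarrow>
        enat n \<le> N \<and>
        ((\<Union>q\<in>Q. H q) = UNIV \<longrightarrow>
           enat n \<le> min (enat (card Q) * Pack nrm r (unit_sphere nrm)) N)) \<and>
     (\<forall>n. halts nrm F \<epsilon> \<theta> \<delta> n Fail \<longrightarrow> \<not> (\<exists>C. robust_lyapunov nrm F \<epsilon> \<theta> \<delta> C)) \<and>
     (\<forall>n C. halts nrm F \<epsilon> \<theta> \<delta> n (Output C) \<longrightarrow>
        finite C \<and> C \<noteq> {} \<and> lyapunov nrm F (poly_fun C))"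
proof -
  interpret pwl_learning nrm Q H A F \<epsilon> \<theta> \<delta> r
    using assms by unfold_locales
  have "finite C \<and> C \<noteq> {} \<and> lyapunov nrm F (poly_fun C)"
    if "halts nrm F \<epsilon> \<theta> \<delta> n (Output C)" for n C
  proof -
    obtain X V x where run: "execution nrm F \<epsilon> \<theta> \<delta> n X V x"
      and sol: "learner_solution nrm F \<epsilon> \<theta> \<delta> (X n) C"
      and none: "\<not> (\<exists>y. verifier_solution F C y)"
      using \<open>halts nrm F \<epsilon> \<theta> \<delta> n (Output C)\<close> unfolding halts_def by auto
    have "finite (X n)"
      using execution_witnesses[OF run order_refl] by simp
    then have "finite C"
      using sol by (rule learner_solution_finite)
    then show ?thesis
      using unrefuted_candidate_lyapunov[OF _ none] by blast
  qed
  moreover have "\<not> (\<exists>C. robust_lyapunov nrm F \<epsilon> \<theta> \<delta> C)" if "halts nrm F \<epsilon> \<theta> \<delta> n Fail" for n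
    using that robust_lyapunov_solves_learner unfolding halts_def by auto
  ultimately show ?thesis
    using no_infinite_run run_le_max_nonclose run_le_modes_times_Pack assms(8) by auto
qed

end
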